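(* Let $n\ge 4$, and let $\alpha\neq 1,\ n-1$. Let $\boldsymbol{v}$ be a geodesible vector field on $\mathbb{S}^{n-1}$. Define $$\boldsymbol{u}(\boldsymbol{x})=\frac{1}{\rho^{\alpha}}\bigl(\boldsymbol{v}(\boldsymbol{y})+f(\boldsymbol{y})\boldsymbol{y}\bigr),\qquad p(\boldsymbol{x})=\frac{1}{\rho^{2\alpha}}q(\boldsymbol{y}),$$ where $\rho=|\boldsymbol{x}|$ and $\boldsymbol{y}=\boldsymbol{x}/|\boldsymbol{x}|\in\mathbb{S}^{n-1}$ for $\boldsymbol{x}\in\mathbb{R}^n\setminus\{0\}$. Then $(\boldsymbol{u},p)$ is a $(-\alpha)$-homogeneous solution to the steady Euler equations $$\iota_{\boldsymbol{u}}du+d\Pi=0,\qquad \operatorname{div}\boldsymbol{u}=0\qquad\text{on }\mathbb{R}^{n}\setminus\{0\}$$ if and only if $\alpha\neq 0$ and $n$ is even and $|\boldsymbol{v}|$ is constant. In this case, $f=0$, $q=-\frac{1}{2\alpha}|\boldsymbol{v}|^{2}$, and the Bernoulli function is given by $$\Pi(\boldsymbol{x})=\frac12\left(1-\frac1\alpha\right)\frac{1}{\rho^{2\alpha}}|\boldsymbol{v}|^{2}.$$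
   Context: $\mathbb{R}^n\setminus\{0\}$ carries the flat metric and $\mathbb{S}^{n-1}$ its standard metric; $\alpha\in\mathbb{R}$. In the definition of $(\boldsymbol{u},p)$, $\boldsymbol{v}$ is a tangential vector field on $\mathbb{S}^{n-1}$ and $f,q$ are scalar functions on $\mathbb{S}^{n-1}$. $u=\boldsymbol{u}^{\flat}$ is the one-form associated with $\boldsymbol{u}$ by the flat metric, $d$ is the exterior derivative, $\iota_{\boldsymbol{u}}$ is contraction with $\boldsymbol{u}$, and $\Pi=p+\frac12|\boldsymbol{u}|^2$ is the Bernoulli function. The first Euler equation is the differential form formulation of $\boldsymbol{u}\cdot\nabla\boldsymbol{u}+\nabla p=0$. $(\boldsymbol{u},p)$ is a $(-\alpha)$-homogeneous solution if it satisfies the Euler equations, $\boldsymbol{u}$ is $(-\alpha)$-homogeneous and $p$ is $(-2\alpha)$-homogeneous, that is, $\boldsymbol{u}(\boldsymbol{x})=\lambda^{\alpha}\boldsymbol{u}(\lambda\boldsymbol{x})$ and $p(\boldsymbol{x})=\lambda^{2\alpha}p(\lambda\boldsymbol{x})$ for all $\lambda>0$ and $\boldsymbol{x}\in\mathbb{R}^n\setminus\{0\}$. A vector field $\boldsymbol{v}$ on $\mathbb{S}^{n-1}$ is called geodesible if $\iota_{\boldsymbol{v}}dv=0$ and $\operatorname{div}_S\boldsymbol{v}=0$, even if $\boldsymbol{v}$ has zeros; here $v=\boldsymbol{v}^{\flat}$ is the dual one-form on $\mathbb{S}^{n-1}$ and $\operatorname{div}_S$ is the divergence on $\mathbb{S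}^{n-1}$.
   Formalization: The equivalence is stated for v not identically zero (for v=0 the zero solution exists for every α and n) and says that some f, q give a solution; when α≠0, n is even and |v| is constant, (u,p) is a solution exactly for the stated f and q. *)

theory Defs
  imports "HOL-Analysis.Analysis"
begin

text \<open>
  Points and tangent vectors of \<open>\<real>\<^sup>n\<close> are both elements of \<^typ>\<open>real^'n\<close>.
  A one-form is a map \<open>\<omega> x h\<close> (point, tangent vector), linear in \<open>h\<close>, and a two-form a map
  \<open>\<beta> x h k\<close>.  Recall that \<open>sgn x = x / |x|\<close> in a normed space; this is the radial
  retraction of \<open>\<real>\<^sup>n - {0}\<close> onto the unit sphere.
\<close>

definition C1_on :: "('a::euclidean_space \<Rightarrow> 'b::real_normed_vector) \<Rightarrow> 'a set \<Rightarrow> bool" where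
  "C1_on f S \<longleftrightarrow> (\<forall>x\<in>S. f differentiable (at x)) \<and>
     (\<forall>h. continuous_on S (\<lambda>x. frechet_derivative f (at x) h))"

definition flat :: "(real^'n \<Rightarrow> real^'n) \<Rightarrow> real^'n \<Rightarrow> real^'n \<Rightarrow> real" where
  "flat u x h = u x \<bullet> h"

definition d0 :: "(real^'n \<Rightarrow> real) \<Rightarrow> real^'n \<Rightarrow> real^'n \<Rightarrow> real" where
  "d0 g x h = frechet_derivative g (at x) h"

text \<open>
  Cartan's formula \<open>d\<omega>(h,k) = h(\<omega>(k)) - k(\<omega>(h)) - \<omega>([h,k])\<close> for constant fields \<open>h\<close>, \<open>k\<close>.
\<close>

definition d1 :: "(real^'n \<Rightarrow> real^'n \<Rightarrow> real) \<Rightarrow> real^'n \<Rightarrow> real^'n \<Rightarrow> real^'n \<Rightarrow> real" where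
  "d1 \<omega> x h k = frechet_derivative (\<lambda>z. \<omega> z k) (at x) h - frechet_derivative (\<lambda>z. \<omega> z h) (at x) k"

definition contraction ::
    "(real^'n \<Rightarrow> real^'n) \<Rightarrow> (real^'n \<Rightarrow> real^'n \<Rightarrow> real^'n \<Rightarrow> real) \<Rightarrow> real^'n \<Rightarrow> real^'n \<Rightarrow> real" where
  "contraction u \<beta> x k = \<beta> x (u x) k"

definition divergence :: "(real^'n \<Rightarrow> real^'n) \<Rightarrow> real^'n \<Rightarrow> real" where
  "divergence u x = trace (jacobian u (at x))"

definition bernoulli :: "(real^'n \<Rightarrow> real^'n) \<Rightarrow> (real^'n \<Rightarrow> real) \<Rightarrow> real^'n \<Rightarrow> real" where
  "bernoulli u p x = p x + 1/2 * (norm (u x))\<^sup>2"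

definition steady_euler :: "(real^'n \<Rightarrow> real^'n) \<Rightarrow> (real^'n \<Rightarrow> real) \<Rightarrow> bool" where
  "steady_euler u p \<longleftrightarrow>
     C1_on u (- {0}) \<and> C1_on p (- {0}) \<and>
     (\<forall>x. x \<noteq> 0 \<longrightarrow>
        (\<forall>k. contraction u (d1 (flat u)) x k + d0 (bernoulli u p) x k = 0) \<and>
        divergence u x = 0)"

definition homogeneous_solution ::
    "real \<Rightarrow> (real^'n \<Rightarrow> real^'n) \<Rightarrow> (real^'n \<Rightarrow> real) \<Rightarrow> bool" where
  "homogeneous_solution \<alpha> u p \<longleftrightarrow>
     steady_euler u p \<and>
     (\<forall>l>0. \<forall>x. x \<noteq> 0 \<longrightarrow>
        u x = (l powr \<alpha>) *\<^sub>R u (l *\<^sub>R x) \<and> p x = l powr (2 * \<alpha>) * p (l *\<^sub>R x))"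

text \<open>
  Tensor fields on the unit sphere are maps on \<^typ>\<open>real^'n\<close> of which only the values at
  unit vectors matter.  They are extended to \<open>\<real>\<^sup>n - {0}\<close> by composition with \<^term>\<open>sgn\<close>,
  and are \<open>C\<^sup>1\<close> on the sphere iff this extension is \<open>C\<^sup>1\<close>.
\<close>

definition tangent :: "real^'n \<Rightarrow> (real^'n) set" where
  "tangent y = {h. h \<bullet> y = 0}"

definition tangent_proj :: "real^'n \<Rightarrow> real^'n \<Rightarrow> real^'n" where
  "tangent_proj y h = h - (h \<bullet> y) *\<^sub>R y"

definition sphere_vector_field :: "(real^'n \<Rightarrow> real^'n) \<Rightarrow> bool" where
  "sphere_vector_field v \<longleftrightarrow>
     (\<forall>y\<in>sphere 0 1. v y \<in> tangent y) \<and> C1_on (\<lambda>x. v (sgn x)) (- {0})"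

text \<open>
  Exterior derivative on the sphere: the one-form \<open>\<lambda>x. \<omega> (sgn x)\<close> on \<open>\<real>\<^sup>n - {0}\<close> pulls back to
  \<open>\<omega>\<close> under the inclusion of the sphere, and the pull-back commutes with the exterior derivative.
  The value is meaningful for \<open>h\<close>, \<open>k\<close> tangent at \<open>y\<close>.
\<close>

definition sphere_d1 :: "(real^'n \<Rightarrow> real^'n \<Rightarrow> real) \<Rightarrow> real^'n \<Rightarrow> real^'n \<Rightarrow> real^'n \<Rightarrow> real" where
  "sphere_d1 \<omega> y h k = d1 (\<lambda>x. \<omega> (sgn x)) y h k"

text \<open>
  The Levi-Civita connection of the round metric is the tangential part of the flat derivative;
  the divergence is the trace of \<open>h \<mapsto> \<nabla>\<^sub>h v\<close> on the tangent space, computed as the trace on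
  \<open>\<real>\<^sup>n\<close> of its extension by 0 on the normal line.
\<close>

definition sphere_nabla :: "(real^'n \<Rightarrow> real^'n) \<Rightarrow> real^'n \<Rightarrow> real^'n \<Rightarrow> real^'n" where
  "sphere_nabla v y h = tangent_proj y (frechet_derivative (\<lambda>x. v (sgn x)) (at y) h)"

definition sphere_divergence :: "(real^'n \<Rightarrow> real^'n) \<Rightarrow> real^'n \<Rightarrow> real" where
  "sphere_divergence v y = trace (matrix (\<lambda>h. sphere_nabla v y (tangent_proj y h)))"

definition geodesible :: "(real^'n \<Rightarrow> real^'n) \<Rightarrow> bool" where
  "geodesible v \<longleftrightarrow> sphere_vector_field v \<and>
     (\<forall>y\<in>sphere 0 1.
        (\<forall>k\<in>tangent y. contraction v (sphere_d1 (flat v)) y k = 0) \<and>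
        sphere_divergence v y = 0)"

definition homogeneous_velocity ::
    "real \<Rightarrow> (real^'n \<Rightarrow> real^'n) \<Rightarrow> (real^'n \<Rightarrow> real) \<Rightarrow> real^'n \<Rightarrow> real^'n" where
  "homogeneous_velocity \<alpha> v f x =
     (let y = x /\<^sub>R norm x in (1 / norm x powr \<alpha>) *\<^sub>R (v y + f y *\<^sub>R y))"

definition homogeneous_pressure :: "real \<Rightarrow> (real^'n \<Rightarrow> real) \<Rightarrow> real^'n \<Rightarrow> real" where
  "homogeneous_pressure \<alpha> q x = 1 / norm x powr (2 * \<alpha>) * q (x /\<^sub>R norm x)"

end

theory Submission
  imports Defs "HOL-Homology.Brouwer_Degree"
begin

text \<open>
  By Euler's identity for homogeneous functions, \<open>div u = 0\<close> reads \<open>(n - 1 - \<alpha>) f = 0\<close>, so \<open>f = 0\<close>.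
  The radial momentum equation is then \<open>|v|\<^sup>2 + 2 \<alpha> q = 0\<close>, while \<open>\<iota>\<^sub>v dv = 0\<close> turns the tangential
  one into \<open>d (|v|\<^sup>2 / 2 + q) = 0\<close>.  As \<open>\<alpha> \<noteq> 1\<close>, the two together make \<open>|v|\<close> constant.  A field of
  constant nonzero length on the sphere exists only for even \<open>n\<close>: rotating \<open>x\<close> towards \<open>v x\<close>
  by the angle \<open>\<pi>\<close> is a homotopy from the identity to the antipodal map, whose degree is \<open>(-1)\<^sup>n\<close>.
\<close>

section \<open>The hairy ball theorem\<close>

text \<open>Places the sphere inside \<open>nat \<Rightarrow> real\<close>, so that continuity of
  maps on it can be checked coordinatewise with \<open>continuous_on\<close>.\<close>

lemma nsphere_eq_top_of_set:
  "nsphere p = top_of_set {x. (\<Sum>i\<le>p. x i ^ 2) = 1 \<and> (\<forall>i>p. x i = 0)}"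
  by (simp add: nsphere euclidean_product_topology)

lemma continuous_map_nsphere_permute:
  assumes "bij s" and out: "\<And>i. i > p \<Longrightarrow> s i = i"
  shows "continuous_map (nsphere p) (nsphere p) (\<lambda>x i. x (s i))"
proof -
  have "s permutes {..p}"
    using assms by (auto simp: permutes_def bij_iff)
  then have "(\<Sum>i\<le>p. (x (s i))\<^sup>2) = (\<Sum>i\<le>p. (x i)\<^sup>2)" for x :: "nat \<Rightarrow> real"
    using sum.permute[of s "{..p}" "\<lambda>i. (x i)\<^sup>2"] by (simp add: o_def)
  then show ?thesis
    unfolding nsphere_eq_top_of_set
    by (auto simp: out intro!: continuous_on_coordinatewise_then_product
        continuous_on_subset[OF continuous_on_product_coordinates])
qed

section \<open>Degrees of reflections and of the antipodal map\<close>

text \<open>Reduces to the known case of coordinate 0 by means of the transposition of 0 and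
  \<open>k\<close>.\<close>

lemma Brouwer_degree2_reflection_coordinate:
  assumes "k \<le> p"
  shows "Brouwer_degree2 p (\<lambda>x i. if i = k then - x i else x i) = -1"
proof -
  let ?t = "Transposition.transpose 0 k :: nat \<Rightarrow> nat"
  define s where "s \<equiv> \<lambda>(x::nat\<Rightarrow>real) i. x (?t i)"
  define r where "r \<equiv> \<lambda>j (x::nat\<Rightarrow>real) i. if i = j then - x i else x i"
  have s: "continuous_map (nsphere p) (nsphere p) s"
    unfolding s_def using assms
    by (intro continuous_map_nsphere_permute bij_transpose) (auto simp: Transposition.transpose_def)
  have r: "continuous_map (nsphere p) (nsphere p) (r j)" for j
    unfolding r_def by (rule continuous_map_nsphere_reflection)
  \<comment> \<open>The degree of \<open>s\<close> squares to 1, so its sign, left undetermined,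
    cancels in the conjugate.\<close>
  have "s \<circ> s = id"
    by (auto simp: s_def fun_eq_iff)
  then have ss: "Brouwer_degree2 p s * Brouwer_degree2 p s = 1"
    by (metis Brouwer_degree2_compose Brouwer_degree2_id s)
  \<comment> \<open>conjugation by the involution \<open>s\<close> does not change the degree\<close>
  have "r k = s \<circ> (r 0 \<circ> s)"
    by (auto simp: s_def r_def fun_eq_iff Transposition.transpose_def)
  then have "Brouwer_degree2 p (r k)
      = Brouwer_degree2 p s * (Brouwer_degree2 p (r 0) * Brouwer_degree2 p s)"
    using r s by (simp add: Brouwer_degree2_compose continuous_map_compose)
  also have "\<dots> = -1"
    using ss Brouwer_degree2_reflection[of p] by (simp add: r_def)
  finally show ?thesis by (simp add: r_def)
qed

text \<open>The p-sphere has p + 1 coordinates; negating them one after another composes p + 1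
  reflections of degree -1.\<close>

lemma Brouwer_degree2_antipodal: "Brouwer_degree2 p (\<lambda>x i. - x i) = (-1) ^ Suc p"
proof -
  define r where "r \<equiv> \<lambda>j (x::nat\<Rightarrow>real) i. if i = j then - x i else x i"
  define a where "a \<equiv> \<lambda>m (x::nat\<Rightarrow>real) i. if i < m then - x i else x i"
  have r: "continuous_map (nsphere p) (nsphere p) (r j)" for j
    unfolding r_def by (rule continuous_map_nsphere_reflection)
  have step: "a (Suc m) = r m \<circ> a m" for m
    by (auto simp: r_def a_def fun_eq_iff)
  \<comment> \<open>Continuity joins the induction because the degree is multiplicative only for
    continuous maps.\<close>
  have "continuous_map (nsphere p) (nsphere p) (a m) \<and> Brouwer_degree2 p (a m) = (-1) ^ m"
    if "m \<le> Suc p" for m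
    using that
  proof (induction m)
    case 0
    have "a 0 = id" by (auto simp: a_def)
    then show ?case by (metis Brouwer_degree2_id continuous_map_id power_0)
  next
    case (Suc m)
    have "Brouwer_degree2 p (r m) = -1"
      unfolding r_def using Suc.prems by (intro Brouwer_degree2_reflection_coordinate) auto
    then show ?case
      using Suc r[of m] continuous_map_compose[of "nsphere p" "nsphere p" "a m" "nsphere p" "r m"]
      unfolding step by (simp add: Brouwer_degree2_compose del: o_apply)
  qed
  then have "Brouwer_degree2 p (a (Suc p)) = (-1) ^ Suc p" by blast
  \<comment> \<open>The two maps agree on the sphere, where the coordinates past \<open>p\<close>
    are 0.\<close>
  moreover have "Brouwer_degree2 p (a (Suc p)) = Brouwer_degree2 p (\<lambda>x i. - x i)"
    by (rule Brouwer_degree2_eq) (auto simp: a_def nsphere_eq_top_of_set)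
  ultimately show ?thesis by simp
qed

section \<open>Unit tangent fields and parity\<close>

text \<open>Here \<open>p\<close> is the dimension of the sphere, one less than that of its ambient
  space. The rotation homotopy forces \<open>(-1) ^ Suc p = 1\<close>.\<close>

lemma hairy_ball_nsphere:
  fixes w :: "(nat \<Rightarrow> real) \<Rightarrow> nat \<Rightarrow> real"
  assumes cont: "continuous_map (nsphere p) (nsphere p) w"
    and orth: "\<And>x. x \<in> topspace (nsphere p) \<Longrightarrow> (\<Sum>i\<le>p. x i * w x i) = 0"
  shows "odd p"
proof -
  define S where "S \<equiv> {x::nat \<Rightarrow> real. (\<Sum>i\<le>p. x i ^ 2) = 1 \<and> (\<forall>i>p. x i = 0)}"
  have S: "nsphere p = top_of_set S"
    unfolding S_def by (rule nsphere_eq_top_of_set)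
  \<comment> \<open>Rotation by the angle pi t in the plane of \<open>x\<close> and
    \<open>w x\<close>: t = 0 gives \<open>x\<close> and t = 1 gives its antipode.\<close>
  define h where "h \<equiv> \<lambda>(t, x) i. cos (pi * t) * x i + sin (pi * t) * w x i"
  have w: "continuous_on S w" "w \<in> S \<rightarrow> S"
    using cont unfolding S by auto
  have wi: "continuous_on S (\<lambda>x. w x i)" for i
    using continuous_on_product_then_coordinatewise[OF w(1)] .
  have "continuous_on ({0..1} \<times> S) (\<lambda>z. cos (pi * fst z) * snd z i + sin (pi * fst z) * w (snd z) i)" for i
    by (intro continuous_intros continuous_on_compose2[OF wi]
        continuous_on_compose2[OF continuous_on_product_coordinates]) auto
  then have "continuous_on ({0..1} \<times> S) h"
    unfolding h_def case_prod_unfold by (intro continuous_on_coordinatewise_then_product)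
  moreover have "h (t, x) \<in> S" if "x \<in> S" for t x
  proof -
    \<comment> \<open>Orthogonality removes the cross term, and what is left is cos^2 +
      sin^2.\<close>
    have "(\<Sum>i\<le>p. (h (t, x) i)\<^sup>2)
        = (\<Sum>i\<le>p. (cos (pi*t))\<^sup>2 * (x i)\<^sup>2 + (sin (pi*t))\<^sup>2 * (w x i)\<^sup>2
             + 2 * cos (pi*t) * sin (pi*t) * (x i * w x i))"
      by (simp add: h_def power2_eq_square algebra_simps)
    also have "\<dots> = (cos (pi*t))\<^sup>2 * (\<Sum>i\<le>p. (x i)\<^sup>2) + (sin (pi*t))\<^sup>2 * (\<Sum>i\<le>p. (w x i)\<^sup>2)
             + 2 * cos (pi*t) * sin (pi*t) * (\<Sum>i\<le>p. x i * w x i)"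
      by (simp only: sum.distrib sum_distrib_left)
    also have "\<dots> = 1"
      using that w(2) orth[of x] by (auto simp: S_def nsphere_eq_top_of_set Pi_iff)
    finally show ?thesis
      using that w(2) by (auto simp: S_def h_def Pi_iff)
  qed
  ultimately have "homotopic_with (\<lambda>x. True) (nsphere p) (nsphere p) id (\<lambda>x i. - x i)"
    unfolding S homotopic_with_def
    by (intro exI[of _ h]) (auto simp: h_def)
  then have "(-1::int) ^ Suc p = 1"
    using Brouwer_degree2_homotopic Brouwer_degree2_antipodal Brouwer_degree2_id by metis
  then show ?thesis
    by (metis even_Suc neg_one_odd_power one_neq_neg_one)
qed

text \<open>Normalising \<open>v\<close> gives a unit tangent field, which an enumeration of the
  index type carries to the standard sphere in \<open>nat \<Rightarrow> real\<close>.\<close>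

theorem hairy_ball:
  fixes v :: "real^'n \<Rightarrow> real^'n"
  assumes cont: "continuous_on (sphere 0 1) v"
    and orth: "\<And>y. y \<in> sphere 0 1 \<Longrightarrow> v y \<bullet> y = 0"
    and nz: "\<And>y. y \<in> sphere 0 1 \<Longrightarrow> v y \<noteq> 0"
  shows "even CARD('n)"
proof -
  define p where "p \<equiv> CARD('n) - 1"
  have p: "CARD('n) = Suc p" by (simp add: p_def)
  obtain b :: "nat \<Rightarrow> 'n" where b: "bij_betw b {..p} UNIV"
    using ex_bij_betw_nat_finite[of "UNIV::'n set"]
    by (auto simp: p atLeast0LessThan lessThan_Suc_atMost)
  define c where "c \<equiv> inv_into {..p} b"
  have c: "c (b i) = i" if "i \<le> p" for i
    using that b by (auto simp: c_def bij_betw_def)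
  have sum_b: "(\<Sum>i\<le>p. g (b i)) = (\<Sum>j\<in>UNIV. g j)" for g :: "'n \<Rightarrow> real"
    by (rule sum.reindex_bij_betw[OF b])
  \<comment> \<open>\<open>e\<close> turns a sequence into a vector along the enumeration
    \<open>b\<close>, whose inverse is \<open>c\<close>; coordinates past \<open>p\<close> are
    dropped.\<close>
  define e where "e \<equiv> \<lambda>x::nat\<Rightarrow>real. \<chi> j. x (c j)"
  have e: "(\<Sum>i\<le>p. x i * (y $ b i)) = e x \<bullet> y" for x y
  proof -
    have "(\<Sum>i\<le>p. x i * (y $ b i)) = (\<Sum>i\<le>p. x (c (b i)) * (y $ b i))"
      by (intro sum.cong) (auto simp: c)
    then show ?thesis
      using sum_b[of "\<lambda>j. x (c j) * y $ j"] by (simp add: e_def inner_vec_def)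
  qed
  define S where "S \<equiv> {x::nat \<Rightarrow> real. (\<Sum>i\<le>p. x i ^ 2) = 1 \<and> (\<forall>i>p. x i = 0)}"
  have S: "nsphere p = top_of_set S"
    unfolding S_def by (rule nsphere_eq_top_of_set)
  have eS: "e x \<in> sphere 0 1" if "x \<in> S" for x
  proof -
    have "e x \<bullet> e x = (\<Sum>i\<le>p. x i * (e x $ b i))" by (simp add: e)
    also have "\<dots> = (\<Sum>i\<le>p. (x i)\<^sup>2)"
      by (intro sum.cong) (auto simp: e_def c power2_eq_square)
    finally show ?thesis using that by (simp add: S_def norm_eq_1)
  qed
  \<comment> \<open>\<open>sgn\<close> makes \<open>w\<close> a self-map of the sphere and is
    continuous here because \<open>v\<close> has no zeros. The value 0 past \<open>p\<close> is what
    membership in \<open>S\<close> demands.\<close>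
  define w where "w \<equiv> \<lambda>x i. if i \<le> p then sgn (v (e x)) $ b i else 0"
  have "continuous_on S e"
    unfolding e_def
    by (intro continuous_on_vec_lambda continuous_on_subset[OF continuous_on_product_coordinates]) auto
  then have ce: "continuous_on S (\<lambda>x. v (e x))"
    using continuous_on_compose2[OF cont] eS by blast
  have "continuous_on S (\<lambda>x. sgn (v (e x)))"
    by (intro continuous_intros ce) (use nz eS in blast)
  then have "continuous_on S (\<lambda>x. w x i)" for i
    unfolding w_def by (cases "i \<le> p") (auto intro: continuous_on_component)
  then have "continuous_on S w"
    by (intro continuous_on_coordinatewise_then_product)
  moreover have "w x \<in> S" if "x \<in> S" for x
  proof -
    have "(\<Sum>i\<le>p. (w x i)\<^sup>2) = (\<Sum>i\<le>p. (sgn (v (e x)) $ b i)\<^sup>2)"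
      by (intro sum.cong) (auto simp: w_def)
    also have "\<dots> = sgn (v (e x)) \<bullet> sgn (v (e x))"
      using sum_b[of "\<lambda>j. (sgn (v (e x)) $ j)\<^sup>2"] by (simp add: inner_vec_def power2_eq_square)
    also have "\<dots> = 1"
      using nz eS[OF that] by (simp add: dot_square_norm norm_sgn)
    finally show ?thesis by (simp add: S_def w_def)
  qed
  moreover have "(\<Sum>i\<le>p. x i * w x i) = 0" if "x \<in> S" for x
  proof -
    have "(\<Sum>i\<le>p. x i * w x i) = (\<Sum>i\<le>p. x i * (sgn (v (e x)) $ b i))"
      by (intro sum.cong) (auto simp: w_def)
    also have "\<dots> = 0"
      using orth[OF eS[OF that]] by (simp only: e) (simp add: sgn_div_norm inner_commute)
    finally show ?thesis .
  qed
  ultimately have "odd p"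
    by (intro hairy_ball_nsphere[of p w]) (auto simp: S)
  then show ?thesis by (simp add: p)
qed

section \<open>Homogeneous functions, traces and the momentum equation\<close>

text \<open>The power \<open>norm x powr a\<close> is kept whole, with a separate division by the
  squared norm, so that it can be factored out of the equations later.\<close>

lemma has_derivative_norm_powr:
  fixes x :: "'a::real_inner"
  assumes "x \<noteq> 0"
  shows "((\<lambda>z. norm z powr a) has_derivative (\<lambda>h. a * norm x powr a * (x \<bullet> h) / (norm x)\<^sup>2)) (at x)"
proof -
  have "((\<lambda>z. norm z powr a) has_derivative
      (\<lambda>h. norm x powr a * (0 * ln (norm x) + (h \<bullet> sgn x) * a / norm x))) (at x)"
    using assms by (intro has_derivative_powr has_derivative_norm has_derivative_const) auto
  also have "(\<lambda>h. norm x powr a * (0 * ln (norm x) + (h \<bullet> sgn x) * a / norm x))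
      = (\<lambda>h. a * norm x powr a * (x \<bullet> h) / (norm x)\<^sup>2)"
    using assms by (auto simp: sgn_div_norm inner_commute power2_eq_square field_simps)
  finally show ?thesis .
qed

text \<open>Euler's identity: differentiate \<open>g (t *\<^sub>R x)\<close> at t = 1 by the chain
  rule and by homogeneity.\<close>

lemma homogeneous_derivative_radial:
  fixes g :: "'a::real_normed_vector \<Rightarrow> 'b::real_normed_vector"
  assumes "(g has_derivative D) (at x)"
    and hom: "\<And>t. t > 0 \<Longrightarrow> g (t *\<^sub>R x) = t powr a *\<^sub>R g x"
  shows "D x = a *\<^sub>R g x"
proof -
  have g: "(g has_derivative D) (at (1 *\<^sub>R x))" using assms by simp
  have "((\<lambda>t. t *\<^sub>R x) has_derivative (\<lambda>s. s *\<^sub>R x)) (at (1::real))"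
    by (auto intro!: derivative_eq_intros)
  from has_derivative_compose[OF this g]
  have 1: "((\<lambda>t. g (t *\<^sub>R x)) has_derivative (\<lambda>s. D (s *\<^sub>R x))) (at 1)" .
  have "((\<lambda>t. t powr a *\<^sub>R g x) has_derivative (\<lambda>s. (s * a) *\<^sub>R g x)) (at (1::real))"
    by (auto intro!: derivative_eq_intros)
  then have "((\<lambda>t. g (t *\<^sub>R x)) has_derivative (\<lambda>s. (s * a) *\<^sub>R g x)) (at 1)"
    by (rule has_derivative_transform_within_open[where s="{0<..}"]) (auto simp: hom)
  from has_derivative_unique[OF 1 this] have "D (1 *\<^sub>R x) = (1 * a) *\<^sub>R g x" by metis
  then show ?thesis by simp
qed

text \<open>Chain rule through the dilation by \<open>c\<close>: a function of degree 0 has a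
  derivative of degree -1.\<close>

lemma homogeneous_derivative_scale:
  fixes g :: "'a::real_normed_vector \<Rightarrow> 'b::real_normed_vector"
  assumes x: "(g has_derivative D) (at x)" and cx: "(g has_derivative E) (at (c *\<^sub>R x))"
    and hom: "\<And>z. g (c *\<^sub>R z) = g z"
  shows "D h = c *\<^sub>R E h"
proof -
  have "((\<lambda>z. c *\<^sub>R z) has_derivative (\<lambda>h. c *\<^sub>R h)) (at x)"
    by (auto intro!: derivative_eq_intros)
  from has_derivative_compose[OF this cx]
  have "(g has_derivative (\<lambda>h. E (c *\<^sub>R h))) (at x)" by (simp add: hom)
  from has_derivative_unique[OF x this] show ?thesis
    using has_derivative_linear[OF cx] by (simp add: linear_cmul)
qed

lemma trace_matrix: "trace (matrix f) = (\<Sum>i\<in>UNIV. f (axis i 1) $ i)"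
  by (simp add: trace_def matrix_def)

lemma trace_matrix_add:
  fixes f g :: "real^'n \<Rightarrow> real^'n"
  shows "trace (matrix (\<lambda>h. f h + g h)) = trace (matrix f) + trace (matrix g)"
  by (simp add: trace_matrix sum.distrib)

lemma trace_matrix_scaleR:
  fixes f :: "real^'n \<Rightarrow> real^'n"
  shows "trace (matrix (\<lambda>h. c *\<^sub>R f h)) = c * trace (matrix f)"
  by (simp add: trace_matrix sum_distrib_left)

text \<open>Expand \<open>w\<close> in the standard basis.\<close>

lemma trace_matrix_rank1:
  fixes L :: "real^'n \<Rightarrow> real"
  assumes "linear L"
  shows "trace (matrix (\<lambda>h. L h *\<^sub>R w)) = L w"
proof -
  have "L w = L (\<Sum>i\<in>UNIV. (w $ i) *\<^sub>R axis i 1)"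
    using basis_expansion[of w] by (simp add: scalar_mult_eq_scaleR)
  also have "\<dots> = (\<Sum>i\<in>UNIV. w $ i * L (axis i 1))"
    using assms by (simp add: linear_sum linear_cmul)
  finally show ?thesis by (simp add: trace_matrix mult.commute)
qed

lemma trace_matrix_ident: "trace (matrix (\<lambda>h::real^'n. h)) = real CARD('n)"
  by (simp add: trace_matrix)

text \<open>Recovers the classical form of the equation. The contraction is
  \<open>A (u x) \<bullet> k - A k \<bullet> u x\<close>, and the derivative of the kinetic term of
  the Bernoulli function cancels its second half.\<close>

lemma momentum_eq:
  assumes u: "(u has_derivative A) (at x)" and p: "(p has_derivative B) (at x)"
  shows "contraction u (d1 (flat u)) x k + d0 (bernoulli u p) x k = A (u x) \<bullet> k + B k"
proof -
  have "((\<lambda>z. flat u z h) has_derivative (\<lambda>k. A k \<bullet> h)) (at x)" for h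
    unfolding flat_def using u by (auto intro!: derivative_eq_intros)
  then have 1: "frechet_derivative (\<lambda>z. flat u z h) (at x) = (\<lambda>k. A k \<bullet> h)" for h
    by (rule frechet_derivative_at[symmetric])
  have "(bernoulli u p has_derivative (\<lambda>k. B k + A k \<bullet> u x)) (at x)"
    unfolding bernoulli_def power2_norm_eq_inner using u p
    by (auto intro!: derivative_eq_intros simp: inner_commute)
  then have 2: "frechet_derivative (bernoulli u p) (at x) = (\<lambda>k. B k + A k \<bullet> u x)"
    by (rule frechet_derivative_at[symmetric])
  show ?thesis
    by (simp add: contraction_def d1_def d0_def 1 2)
qed

lemma divergence_eq:
  "(u has_derivative A) (at x) \<Longrightarrow> divergence u x = trace (matrix A)"
  unfolding divergence_def jacobian_def using frechet_derivative_at by metis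

section \<open>Homogeneous Euler flows over a geodesible field\<close>

locale geodesible_field =
  fixes v :: "real^'n \<Rightarrow> real^'n"
  assumes geodesible: "geodesible v"
begin

section \<open>The extension constant along rays, and its derivative\<close>

text \<open>The derivatives on the sphere are defined through this same extension, so geodesibility
  turns into flat identities for its derivative \<open>DV\<close>.\<close>

definition V :: "real^'n \<Rightarrow> real^'n" where "V x = v (sgn x)"

definition DV :: "real^'n \<Rightarrow> real^'n \<Rightarrow> real^'n" where "DV x = frechet_derivative V (at x)"

lemma V_scale: "c > 0 \<Longrightarrow> V (c *\<^sub>R x) = V x"
  by (simp add: V_def sgn_scaleR)

lemma V_unit: "norm y = 1 \<Longrightarrow> V y = v y"
  by (simp add: V_def sgn_div_norm)

lemma V_has_derivative: "x \<noteq> 0 \<Longrightarrow> (V has_derivative DV x) (at x)"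
  using geodesible
  unfolding geodesible_def sphere_vector_field_def C1_on_def DV_def V_def frechet_derivative_works
  by auto

lemma linear_DV: "x \<noteq> 0 \<Longrightarrow> linear (DV x)"
  using V_has_derivative has_derivative_linear by blast

lemma continuous_on_V: "continuous_on (- {0}) V"
  using V_has_derivative by (metis ComplD continuous_at_imp_continuous_on has_derivative_continuous singletonI)

lemma continuous_on_DV: "continuous_on (- {0}) (\<lambda>x. DV x h)"
  using geodesible
  unfolding geodesible_def sphere_vector_field_def C1_on_def DV_def V_def
  by auto

lemma V_orthogonal: "V x \<bullet> x = 0"
proof (cases "x = 0")
  case False
  then have "v (sgn x) \<bullet> sgn x = 0"
    using geodesible unfolding geodesible_def sphere_vector_field_def
    by (auto simp: tangent_def norm_sgn)
  then show ?thesis using False by (simp add: V_def sgn_div_norm)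
qed simp

lemma DV_radial: "x \<noteq> 0 \<Longrightarrow> DV x x = 0"
  using homogeneous_derivative_radial[OF V_has_derivative, of x 0] by (simp add: V_scale)

text \<open>Differentiate the tangency relation \<open>V x \<bullet> x = 0\<close>.\<close>

lemma DV_inner_radial:
  assumes "x \<noteq> 0"
  shows "DV x h \<bullet> x = - (V x \<bullet> h)"
proof -
  have "((\<lambda>z. V z \<bullet> z) has_derivative (\<lambda>h. V x \<bullet> h + DV x h \<bullet> x)) (at x)"
    using V_has_derivative[OF assms] by (auto intro!: derivative_eq_intros)
  moreover have "((\<lambda>z. V z \<bullet> z) has_derivative (\<lambda>h. 0)) (at x)"
    by (simp add: V_orthogonal)
  ultimately have "(\<lambda>h. V x \<bullet> h + DV x h \<bullet> x) = (\<lambda>h. 0)"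
    by (rule has_derivative_unique)
  from fun_cong[OF this, of h] show ?thesis by simp
qed

lemma DV_sgn:
  assumes "x \<noteq> 0"
  shows "DV x h = inverse (norm x) *\<^sub>R DV (sgn x) h"
  using homogeneous_derivative_scale[OF V_has_derivative[of x] V_has_derivative[of "inverse (norm x) *\<^sub>R x"]]
    assms by (simp add: V_scale sgn_div_norm)

text \<open>This is the condition \<iota>_v dv = 0. The hypothesis gives it at \<open>sgn x\<close>,
  and both sides pick up the same factor \<open>inverse (norm x)\<close> on passing to
  \<open>x\<close>.\<close>

lemma DV_symmetric:
  assumes "x \<noteq> 0" and "k \<bullet> x = 0"
  shows "DV x (V x) \<bullet> k = DV x k \<bullet> V x"
proof -
  let ?y = "sgn x"
  have y: "norm ?y = 1" "?y \<noteq> 0" using assms by (auto simp: norm_sgn sgn_zero_iff)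
  have "k \<in> tangent ?y" using assms by (simp add: tangent_def sgn_div_norm)
  then have "contraction v (sphere_d1 (flat v)) ?y k = 0"
    using geodesible y unfolding geodesible_def by simp
  moreover have "((\<lambda>z. flat v (sgn z) h) has_derivative (\<lambda>k. DV ?y k \<bullet> h)) (at ?y)" for h
    unfolding flat_def using V_has_derivative[OF y(2)]
    by (auto intro!: derivative_eq_intros simp: V_def[abs_def])
  then have "frechet_derivative (\<lambda>z. flat v (sgn z) h) (at ?y) = (\<lambda>k. DV ?y k \<bullet> h)" for h
    by (rule frechet_derivative_at[symmetric])
  ultimately have "DV ?y (V x) \<bullet> k = DV ?y k \<bullet> V x"
    by (simp add: contraction_def sphere_d1_def d1_def V_def)
  then show ?thesis
    using assms by (simp add: DV_sgn)
qed

text \<open>The divergence on the sphere is the flat one. \<open>DV\<close> kills the radial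
  direction, so projecting its argument changes nothing; projecting its value adds a rank-one map
  with trace \<open>V ?y \<bullet> ?y = 0\<close>.\<close>

lemma trace_DV:
  assumes "x \<noteq> 0"
  shows "trace (matrix (DV x)) = 0"
proof -
  let ?y = "sgn x"
  have y: "norm ?y = 1" "?y \<noteq> 0" using assms by (auto simp: norm_sgn sgn_zero_iff)
  have "sphere_nabla v ?y (tangent_proj ?y h) = DV ?y h + (V ?y \<bullet> h) *\<^sub>R ?y" for h
  proof -
    have "DV ?y (tangent_proj ?y h) = DV ?y h"
      using linear_DV[OF y(2)] DV_radial[OF y(2)]
      by (simp add: tangent_proj_def linear_diff linear_cmul)
    then show ?thesis
      using DV_inner_radial[OF y(2)]
      unfolding sphere_nabla_def DV_def V_def[abs_def]
      by (simp add: tangent_proj_def)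
  qed
  then have "sphere_divergence v ?y
      = trace (matrix (DV ?y)) + trace (matrix (\<lambda>h. (V ?y \<bullet> h) *\<^sub>R ?y))"
    by (simp add: sphere_divergence_def trace_matrix_add)
  also have "trace (matrix (\<lambda>h. (V ?y \<bullet> h) *\<^sub>R ?y)) = V ?y \<bullet> ?y"
    by (intro trace_matrix_rank1 bounded_linear.linear bounded_linear_inner_right)
  finally have "trace (matrix (DV ?y)) = 0"
    using geodesible y by (simp add: geodesible_def V_orthogonal)
  moreover have "DV x = (\<lambda>h. inverse (norm x) *\<^sub>R DV ?y h)"
    using DV_sgn[OF assms] by blast
  ultimately show ?thesis by (simp add: trace_matrix_scaleR)
qed

section \<open>The homogeneous flow without radial part\<close>

definition U :: "real \<Rightarrow> real^'n \<Rightarrow> real^'n" where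
  "U \<alpha> x = norm x powr - \<alpha> *\<^sub>R V x"

definition DU :: "real \<Rightarrow> real^'n \<Rightarrow> real^'n \<Rightarrow> real^'n" where
  "DU \<alpha> x h = norm x powr - \<alpha> *\<^sub>R (DV x h - (\<alpha> * (x \<bullet> h) / (norm x)\<^sup>2) *\<^sub>R V x)"

lemma U_has_derivative:
  assumes "x \<noteq> 0"
  shows "(U \<alpha> has_derivative DU \<alpha> x) (at x)"
proof -
  have "(U \<alpha> has_derivative
      (\<lambda>h. norm x powr - \<alpha> *\<^sub>R DV x h + (- \<alpha> * norm x powr - \<alpha> * (x \<bullet> h) / (norm x)\<^sup>2) *\<^sub>R V x)) (at x)"
    unfolding U_def[abs_def]
    by (intro has_derivative_scaleR has_derivative_norm_powr V_has_derivative assms)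
  also have "(\<lambda>h. norm x powr - \<alpha> *\<^sub>R DV x h + (- \<alpha> * norm x powr - \<alpha> * (x \<bullet> h) / (norm x)\<^sup>2) *\<^sub>R V x)
      = DU \<alpha> x"
    by (auto simp: DU_def algebra_simps)
  finally show ?thesis .
qed

text \<open>Differentiating the power of the norm contributes a rank-one map whose trace is a
  multiple of \<open>x \<bullet> V x = 0\<close>.\<close>

lemma divergence_U:
  assumes "x \<noteq> 0"
  shows "divergence (U \<alpha>) x = 0"
proof -
  have "DU \<alpha> x = (\<lambda>h. norm x powr - \<alpha> *\<^sub>R
      (DV x h + (- \<alpha> / (norm x)\<^sup>2) *\<^sub>R ((x \<bullet> h) *\<^sub>R V x)))"
    by (auto simp: DU_def algebra_simps)
  then have "trace (matrix (DU \<alpha> x)) = norm x powr - \<alpha> *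
      (trace (matrix (DV x)) + (- \<alpha> / (norm x)\<^sup>2) * trace (matrix (\<lambda>h. (x \<bullet> h) *\<^sub>R V x)))"
    by (simp only: trace_matrix_scaleR trace_matrix_add)
  also have "trace (matrix (\<lambda>h. (x \<bullet> h) *\<^sub>R V x)) = x \<bullet> V x"
    by (intro trace_matrix_rank1 bounded_linear.linear bounded_linear_inner_right)
  finally show ?thesis
    using V_orthogonal[of x] trace_DV[OF assms]
    by (simp add: divergence_eq[OF U_has_derivative[OF assms]] inner_commute)
qed

text \<open>\<open>Q\<close> is left general so as to cover both the profile
  \<open>q (sgn x)\<close> of a given solution and the constant profile of the constructed
  one.\<close>

lemma momentum_U:
  assumes x: "x \<noteq> 0" and Q: "(Q has_derivative B) (at x)"
    and p: "p = (\<lambda>z. norm z powr (- 2 * \<alpha>) * Q z)"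
  shows "contraction (U \<alpha>) (d1 (flat (U \<alpha>))) x k + d0 (bernoulli (U \<alpha>) p) x k
    = norm x powr (- 2 * \<alpha>) * (DV x (V x) \<bullet> k + B k - 2 * \<alpha> * (x \<bullet> k) / (norm x)\<^sup>2 * Q x)"
proof -
  let ?r = "norm x powr - \<alpha>"
  have r: "norm x powr (- 2 * \<alpha>) = ?r * ?r" by (simp flip: powr_add)
  have "(p has_derivative (\<lambda>k. norm x powr (- 2 * \<alpha>) * B k +
     (- 2 * \<alpha>) * norm x powr (- 2 * \<alpha>) * (x \<bullet> k) / (norm x)\<^sup>2 * Q x)) (at x)"
    unfolding p by (intro has_derivative_mult has_derivative_norm_powr assms)
  note momentum_eq[OF U_has_derivative[OF x] this, of \<alpha> k]
  \<comment> \<open>The flow is orthogonal to \<open>x\<close>, so the power of the norm is not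
    differentiated along it.\<close>
  also have "DU \<alpha> x (U \<alpha> x) = (?r * ?r) *\<^sub>R DV x (V x)"
    using V_orthogonal[of x] linear_DV[OF x] by (simp add: DU_def U_def linear_cmul inner_commute)
  finally show ?thesis unfolding r by (simp add: algebra_simps)
qed

lemma homogeneous_velocity_eq:
  assumes "x \<noteq> 0"
  shows "homogeneous_velocity \<alpha> v f x = U \<alpha> x + norm x powr - \<alpha> *\<^sub>R f (sgn x) *\<^sub>R sgn x"
  unfolding homogeneous_velocity_def Let_def U_def V_def sgn_div_norm
  by (simp add: powr_minus_divide scaleR_add_right)

lemma homogeneous_velocity_eq_U:
  assumes "\<forall>y\<in>sphere 0 1. f y = 0"
  shows "homogeneous_velocity \<alpha> v f = U \<alpha>"
proof
  fix x
  show "homogeneous_velocity \<alpha> v f x = U \<alpha> x"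
  proof (cases "x = 0")
    case False
    then show ?thesis using assms by (simp add: homogeneous_velocity_eq norm_sgn)
  \<comment> \<open>At the origin both sides are 0, since \<open>0 powr a = 0\<close> and division
    by 0 yields 0.\<close>
  qed (simp add: homogeneous_velocity_def U_def)
qed

section \<open>Vanishing of the radial part\<close>

text \<open>Write u = U + g x with \<open>g\<close> of degree -\<alpha> - 1. As U is divergence
  free, div u is n g plus the radial derivative of \<open>g\<close>, that is (n - 1 - \<alpha>) g by
  Euler's identity.\<close>

lemma radial_component_zero:
  assumes sol: "steady_euler (homogeneous_velocity \<alpha> v f) p"
    and \<alpha>: "\<alpha> \<noteq> real CARD('n) - 1" and y: "y \<in> sphere 0 1"
  shows "f y = 0"
proof -
  let ?u = "homogeneous_velocity \<alpha> v f"
  have ny: "norm y = 1" "y \<noteq> 0" using y by auto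
  then have yy: "y \<bullet> y = 1" by (simp add: dot_square_norm)
  have u: "(?u has_derivative frechet_derivative ?u (at y)) (at y)"
    using sol ny unfolding steady_euler_def C1_on_def frechet_derivative_works by auto
  \<comment> \<open>\<open>f\<close> is not assumed differentiable; \<open>g\<close> recovers it from the differentiable \<open>u\<close>, whose
    radial part is \<open>g x *\<^sub>R x\<close>\<close>
  define g where "g \<equiv> \<lambda>x. (?u x \<bullet> x) / (x \<bullet> x)"
  have "g differentiable (at y)"
    unfolding g_def using u yy
    by (intro differentiable_divide differentiable_inner) (auto simp: differentiable_def)
  then obtain G where G: "(g has_derivative G) (at y)"
    by (auto simp: differentiable_def)
  have g: "g x = norm x powr (- \<alpha> - 1) * f (sgn x)" if "x \<noteq> 0" for x
    using that V_orthogonal[of x]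
    by (simp add: g_def homogeneous_velocity_eq U_def inner_add_left sgn_div_norm powr_diff
        dot_square_norm power2_eq_square field_simps)
  have gy: "g y = f y"
    using ny by (simp add: g sgn_div_norm)
  have Gy: "G y = (- \<alpha> - 1) *\<^sub>R g y"
  proof (rule homogeneous_derivative_radial[OF G])
    fix t :: real assume "t > 0"
    then show "g (t *\<^sub>R y) = t powr (- \<alpha> - 1) *\<^sub>R g y"
      using ny by (simp add: g sgn_scaleR powr_mult)
  qed
  have "((\<lambda>x. U \<alpha> x + g x *\<^sub>R x) has_derivative (\<lambda>h. DU \<alpha> y h + (G h *\<^sub>R y + g y *\<^sub>R h))) (at y)"
    using U_has_derivative[OF ny(2)] G by (auto intro!: derivative_eq_intros)
  then have "(?u has_derivative (\<lambda>h. DU \<alpha> y h + (G h *\<^sub>R y + g y *\<^sub>R h))) (at y)"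
    by (rule has_derivative_transform_within_open[where s="- {0}"])
      (use ny in \<open>auto simp: homogeneous_velocity_eq g sgn_div_norm powr_diff divide_inverse\<close>)
  from divergence_eq[OF this]
  have "divergence ?u y = divergence (U \<alpha>) y + (G y + g y * real CARD('n))"
    by (simp add: trace_matrix_add trace_matrix_scaleR trace_matrix_ident
        trace_matrix_rank1[OF has_derivative_linear[OF G]] divergence_eq[OF U_has_derivative[OF ny(2)]])
  then have "(real CARD('n) - 1 - \<alpha>) * f y = 0"
    using sol ny divergence_U[OF ny(2), of \<alpha>] unfolding steady_euler_def
    by (simp add: Gy gy algebra_simps)
  then show ?thesis using \<alpha> by simp
qed

section \<open>Fields of constant length\<close>

lemma DV_inner_V_zero:
  assumes const: "\<And>x. x \<noteq> 0 \<Longrightarrow> norm (V x) = c" and x: "x \<noteq> 0"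
  shows "DV x h \<bullet> V x = 0"
proof -
  have "((\<lambda>x. V x \<bullet> V x) has_derivative (\<lambda>h. V x \<bullet> DV x h + DV x h \<bullet> V x)) (at x)"
    using V_has_derivative[OF x] by (auto intro!: derivative_eq_intros)
  moreover have "((\<lambda>x. V x \<bullet> V x) has_derivative (\<lambda>h. 0)) (at x)"
    by (rule has_derivative_transform_within_open[where s="- {0}" and f="\<lambda>_. c\<^sup>2"])
      (use x const in \<open>auto simp: dot_square_norm\<close>)
  ultimately have "(\<lambda>h. V x \<bullet> DV x h + DV x h \<bullet> V x) = (\<lambda>h. 0)"
    by (rule has_derivative_unique)
  from fun_cong[OF this, of h] show ?thesis by (simp add: inner_commute)
qed

text \<open>The acceleration is purely centripetal: its tangential part is half the gradient of the
  squared length by \<open>DV_symmetric\<close>, hence zero.\<close>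

lemma DV_advection:
  assumes const: "\<And>x. x \<noteq> 0 \<Longrightarrow> norm (V x) = c" and x: "x \<noteq> 0"
  shows "DV x (V x) \<bullet> k = - (c\<^sup>2 * (x \<bullet> k) / (norm x)\<^sup>2)"
proof -
  \<comment> \<open>\<open>s *\<^sub>R x\<close> is the radial part of \<open>k\<close>.\<close>
  define s where "s = (x \<bullet> k) / (norm x)\<^sup>2"
  have "(k - s *\<^sub>R x) \<bullet> x = 0"
    using x by (simp add: s_def inner_diff_left dot_square_norm inner_commute[of x])
  then have "DV x (V x) \<bullet> (k - s *\<^sub>R x) = 0"
    using DV_symmetric DV_inner_V_zero[OF const] x by simp
  then have "DV x (V x) \<bullet> k = s * (DV x (V x) \<bullet> x)"
    by (simp add: inner_diff_right)
  also have "DV x (V x) \<bullet> x = - c\<^sup>2"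
    using DV_inner_radial[OF x] const[OF x] by (simp add: dot_square_norm)
  finally show ?thesis by (simp add: s_def)
qed

section \<open>Radial and tangential momentum equations\<close>

lemma pressure_has_derivative:
  assumes sol: "steady_euler (U \<alpha>) (homogeneous_pressure \<alpha> q)"
    and x: "x \<noteq> 0"
  obtains B where "((\<lambda>x. q (sgn x)) has_derivative B) (at x)" "B x = 0"
    and "\<And>k. DV x (V x) \<bullet> k + B k - 2 * \<alpha> * (x \<bullet> k) / (norm x)\<^sup>2 * q (sgn x) = 0"
proof -
  let ?p = "homogeneous_pressure \<alpha> q" and ?Q = "\<lambda>x. q (sgn x)"
  have p: "?p = (\<lambda>z. norm z powr (- 2 * \<alpha>) * ?Q z)"
    by (auto simp: homogeneous_pressure_def sgn_div_norm powr_minus divide_simps)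
  have "?p differentiable (at x)"
    using sol x unfolding steady_euler_def C1_on_def by auto
  then obtain P where "(?p has_derivative P) (at x)" by (auto simp: differentiable_def)
  \<comment> \<open>Differentiability of \<open>q\<close> is not given; it comes from the pressure
    multiplied by the inverse power of the norm.\<close>
  from has_derivative_mult[OF has_derivative_norm_powr[OF x, of "2 * \<alpha>"] this]
  obtain B where "((\<lambda>z. norm z powr (2 * \<alpha>) * ?p z) has_derivative B) (at x)" by blast
  then have B: "(?Q has_derivative B) (at x)"
    by (rule has_derivative_transform_within_open[where s="- {0}"])
      (use x in \<open>auto simp: homogeneous_pressure_def sgn_div_norm\<close>)
  moreover have "B x = 0"
    using homogeneous_derivative_radial[OF B, of 0] by (simp add: sgn_scaleR)
  moreover have "DV x (V x) \<bullet> k + B k - 2 * \<alpha> * (x \<bullet> k) / (norm x)\<^sup>2 * q (sgn x) = 0" for k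
    using sol x momentum_U[OF x B p, of k] unfolding steady_euler_def by simp
  ultimately show ?thesis using that by blast
qed

text \<open>Radial component: put k = x, where \<open>B x = 0\<close> and the advection term is
  minus the squared length.\<close>

lemma pressure_eq:
  assumes sol: "steady_euler (U \<alpha>) (homogeneous_pressure \<alpha> q)" and x: "x \<noteq> 0"
  shows "2 * \<alpha> * q (sgn x) = - (norm (V x))\<^sup>2"
proof -
  obtain B where "B x = 0"
    and "\<And>k. DV x (V x) \<bullet> k + B k - 2 * \<alpha> * (x \<bullet> k) / (norm x)\<^sup>2 * q (sgn x) = 0"
    using pressure_has_derivative[OF sol x] by metis
  from this(2)[of x] this(1) show ?thesis
    using x DV_inner_radial[OF x] by (simp add: dot_square_norm)
qed

text \<open>Tangential component: \<open>DV_symmetric\<close> turns advection into the gradient of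
  half the squared length, so the sum with \<open>q\<close> has zero derivative.\<close>

lemma energy_const:
  assumes sol: "steady_euler (U \<alpha>) (homogeneous_pressure \<alpha> q)" and n: "CARD('n) \<ge> 2"
  obtains c where "\<And>x. x \<noteq> 0 \<Longrightarrow> (norm (V x))\<^sup>2 / 2 + q (sgn x) = c"
proof -
  let ?E = "\<lambda>x. (V x \<bullet> V x) / 2 + q (sgn x)"
  have "(?E has_derivative (\<lambda>h. 0)) (at x)" if x: "x \<in> - {0}" for x
  proof -
    have x: "x \<noteq> 0" using x by simp
    obtain B where B: "((\<lambda>x. q (sgn x)) has_derivative B) (at x)" "B x = 0"
      and eq: "\<And>k. DV x (V x) \<bullet> k + B k - 2 * \<alpha> * (x \<bullet> k) / (norm x)\<^sup>2 * q (sgn x) = 0"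
      using pressure_has_derivative[OF sol x] by metis
    have E: "(?E has_derivative (\<lambda>h. DV x h \<bullet> V x + B h)) (at x)"
      using V_has_derivative[OF x] B(1)
      by (auto intro!: derivative_eq_intros simp: inner_commute)
    \<comment> \<open>Tangential directions suffice, because \<open>DV x\<close> and
      \<open>B\<close> both vanish on \<open>x\<close>.\<close>
    have "DV x h \<bullet> V x + B h = 0" for h
    proof -
      define s where "s = (x \<bullet> h) / (norm x)\<^sup>2"
      define k where "k = h - s *\<^sub>R x"
      have h: "h = k + s *\<^sub>R x" by (simp add: k_def)
      have k: "k \<bullet> x = 0"
        using x by (simp add: k_def s_def inner_diff_left dot_square_norm inner_commute[of x])
      have "DV x k \<bullet> V x + B k = 0"
        using eq[of k] DV_symmetric[OF x k] k by (simp add: inner_commute)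
      moreover have "DV x h = DV x k" "B h = B k"
        using linear_DV[OF x] has_derivative_linear[OF B(1)] DV_radial[OF x] B(2)
        by (simp_all add: h linear_add linear_cmul)
      ultimately show ?thesis by simp
    qed
    with E show ?thesis by simp
  qed
  \<comment> \<open>The punctured space is connected from dimension 2 on.\<close>
  moreover have "connected (- {0 :: real^'n})"
    using n by (intro connected_punctured_universe) simp
  ultimately have "?E x = ?E y" if "x \<noteq> 0" "y \<noteq> 0" for x y
    using has_derivative_zero_unique_connected[of "- {0}" ?E x y] that by auto
  then show ?thesis
    using that[of "?E (axis undefined 1)"] by (metis axis_eq_0_iff dot_square_norm zero_neq_one)
qed

section \<open>Construction of the solution\<close>

text \<open>The pressure constant is the one that balances the centripetal acceleration of
  \<open>DV_advection\<close>.\<close>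

lemma steady_euler_constant_norm:
  assumes const: "\<And>x. x \<noteq> 0 \<Longrightarrow> norm (V x) = c" and \<alpha>: "\<alpha> \<noteq> 0"
  shows "steady_euler (U \<alpha>) (\<lambda>x. norm x powr (- 2 * \<alpha>) * - (c\<^sup>2 / (2 * \<alpha>)))"
    (is "steady_euler _ ?p")
proof -
  let ?K = "- (c\<^sup>2 / (2 * \<alpha>))"
  have fU: "frechet_derivative (U \<alpha>) (at x) = DU \<alpha> x" if "x \<noteq> 0" for x
    using frechet_derivative_at[OF U_has_derivative[OF that]] by simp
  have "continuous_on (- {0}) (\<lambda>x. DU \<alpha> x h)" for h
    unfolding DU_def
    by (intro continuous_intros continuous_on_V continuous_on_DV) auto
  then have "continuous_on (- {0}) (\<lambda>x. frechet_derivative (U \<alpha>) (at x) h)" for h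
    by (rule continuous_on_eq) (simp add: fU)
  then have "C1_on (U \<alpha>) (- {0})"
    using U_has_derivative by (auto simp: C1_on_def differentiable_def)
  moreover have p: "(?p has_derivative (\<lambda>h. (- 2 * \<alpha>) * norm x powr (- 2 * \<alpha>) * (x \<bullet> h) / (norm x)\<^sup>2 * ?K)) (at x)"
    if "x \<noteq> 0" for x
    by (intro has_derivative_mult_left has_derivative_norm_powr that)
  have fp: "frechet_derivative ?p (at x) h = (- 2 * \<alpha>) * norm x powr (- 2 * \<alpha>) * (x \<bullet> h) / (norm x)\<^sup>2 * ?K"
    if "x \<noteq> 0" for x h
    by (simp only: frechet_derivative_at[OF p[OF that], symmetric])
  have "continuous_on (- {0}) (\<lambda>x. (- 2 * \<alpha>) * norm x powr (- 2 * \<alpha>) * (x \<bullet> h) / (norm x)\<^sup>2 * ?K)"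
    for h :: "real^'n"
    by (intro continuous_intros) auto
  then have "continuous_on (- {0}) (\<lambda>x. frechet_derivative ?p (at x) h)" for h
    by (rule continuous_on_eq) (simp only: fp Compl_iff singleton_iff not_False_eq_True)
  then have "C1_on ?p (- {0})"
    using p unfolding C1_on_def differentiable_def by blast
  moreover have "contraction (U \<alpha>) (d1 (flat (U \<alpha>))) x k + d0 (bernoulli (U \<alpha>) ?p) x k = 0"
    if "x \<noteq> 0" for x k
  proof -
    have "DV x (V x) \<bullet> k = - (c\<^sup>2 * (x \<bullet> k) / (norm x)\<^sup>2)"
      using const that by (rule DV_advection)
    then show ?thesis
      unfolding momentum_U[OF that has_derivative_const refl] using \<alpha> by simp
  qed
  ultimately show ?thesis
    by (simp add: steady_euler_def divergence_U)
qed

section \<open>Necessary and sufficient conditions\<close>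

text \<open>The scaling laws are built into the ansatz, since positive dilations preserve
  \<open>x /\<^sub>R norm x\<close>.\<close>

lemma homogeneous_solution_iff:
  "homogeneous_solution \<alpha> (homogeneous_velocity \<alpha> v f) (homogeneous_pressure \<alpha> q)
    \<longleftrightarrow> steady_euler (homogeneous_velocity \<alpha> v f) (homogeneous_pressure \<alpha> q)"
proof -
  have "homogeneous_velocity \<alpha> v f x = l powr \<alpha> *\<^sub>R homogeneous_velocity \<alpha> v f (l *\<^sub>R x)
      \<and> homogeneous_pressure \<alpha> q x = l powr (2 * \<alpha>) * homogeneous_pressure \<alpha> q (l *\<^sub>R x)"
    if "l > 0" for l x
  proof -
    have "inverse l * inverse (norm x) * l = inverse (norm x)"
      using that by (simp add: field_simps)
    then have y: "(l *\<^sub>R x) /\<^sub>R norm (l *\<^sub>R x) = x /\<^sub>R norm x"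
      using that by simp
    show ?thesis
      unfolding homogeneous_velocity_def homogeneous_pressure_def Let_def y
      using that by (simp add: powr_mult)
  qed
  then show ?thesis unfolding homogeneous_solution_def by blast
qed

text \<open>The pressure identity is left undivided by \<alpha>, so that for \<alpha> = 0 it still
  forces v = 0 on the sphere.\<close>

lemma solution_necessary:
  assumes "steady_euler (homogeneous_velocity \<alpha> v f) (homogeneous_pressure \<alpha> q)"
    and "\<alpha> \<noteq> real CARD('n) - 1" and y: "y \<in> sphere 0 1"
  shows "f y = 0" and "2 * \<alpha> * q y = - (norm (v y))\<^sup>2"
proof -
  have f: "\<forall>y\<in>sphere 0 1. f y = 0"
    using radial_component_zero assms by blast
  then show "f y = 0" using y by blast
  have "steady_euler (U \<alpha>) (homogeneous_pressure \<alpha> q)"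
    using assms(1) homogeneous_velocity_eq_U[OF f] by simp
  from pressure_eq[OF this, of y] show "2 * \<alpha> * q y = - (norm (v y))\<^sup>2"
    using y by (force simp: V_def sgn_div_norm)
qed

lemma solution_sufficient:
  assumes "\<alpha> \<noteq> 0" and "(\<lambda>y. norm (v y)) constant_on sphere 0 1"
    and fq: "\<And>y. y \<in> sphere 0 1 \<Longrightarrow> f y = 0 \<and> q y = - (1 / (2 * \<alpha>)) * (norm (v y))\<^sup>2"
  shows "steady_euler (homogeneous_velocity \<alpha> v f) (homogeneous_pressure \<alpha> q)"
proof -
  obtain c where c: "\<And>y. y \<in> sphere 0 1 \<Longrightarrow> norm (v y) = c"
    using assms(2) by (auto simp: constant_on_def)
  have "homogeneous_pressure \<alpha> q x = norm x powr (- 2 * \<alpha>) * - (c\<^sup>2 / (2 * \<alpha>))" for x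
  proof (cases "x = 0")
    case False
    then have "sgn x \<in> sphere 0 1" by (simp add: norm_sgn)
    then have "q (sgn x) = - (c\<^sup>2 / (2 * \<alpha>))"
      using fq[of "sgn x"] c[of "sgn x"] by simp
    then show ?thesis
      unfolding homogeneous_pressure_def sgn_div_norm[symmetric]
      by (simp add: powr_minus_divide)
  qed (simp add: homogeneous_pressure_def)
  moreover have "norm (V x) = c" if "x \<noteq> 0" for x
    using c[of "sgn x"] that by (simp add: V_def norm_sgn)
  moreover have "homogeneous_velocity \<alpha> v f = U \<alpha>"
    using fq by (intro homogeneous_velocity_eq_U) blast
  ultimately show ?thesis
    using steady_euler_constant_norm[of c \<alpha>] assms(1) by presburger
qed

lemma norm_constant:
  assumes "steady_euler (homogeneous_velocity \<alpha> v f) (homogeneous_pressure \<alpha> q)"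
    and \<alpha>: "\<alpha> \<noteq> real CARD('n) - 1" "\<alpha> \<noteq> 1" "\<alpha> \<noteq> 0" and n: "CARD('n) \<ge> 2"
  shows "(\<lambda>y. norm (v y)) constant_on sphere 0 1"
proof -
  have "homogeneous_velocity \<alpha> v f = U \<alpha>"
    using radial_component_zero[OF assms(1) \<alpha>(1)] by (intro homogeneous_velocity_eq_U) blast
  then have sol: "steady_euler (U \<alpha>) (homogeneous_pressure \<alpha> q)"
    using assms(1) by simp
  then obtain c where c: "\<And>x. x \<noteq> 0 \<Longrightarrow> (norm (V x))\<^sup>2 / 2 + q (sgn x) = c"
    using energy_const n by blast
  \<comment> \<open>Eliminating \<open>q y\<close> from the energy and pressure identities gives
    \<open>(norm (v y))\<^sup>2 * (\<alpha> - 1) = 2 * c * \<alpha>\<close>, whose solution does not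
    depend on \<open>y\<close>.\<close>
  have "norm (v y) = sqrt (2 * c * \<alpha> / (\<alpha> - 1))" if "y \<in> sphere 0 1" for y
  proof -
    have y: "norm y = 1" "y \<noteq> 0" using that by auto
    then have c: "c = (norm (v y))\<^sup>2 / 2 + q y" and q: "2 * \<alpha> * q y = - (norm (v y))\<^sup>2"
      using c[of y] pressure_eq[OF sol, of y] by (simp_all add: V_def sgn_div_norm)
    have "2 * c * \<alpha> = (norm (v y))\<^sup>2 * \<alpha> + 2 * \<alpha> * q y"
      by (simp add: c algebra_simps)
    then have "(norm (v y))\<^sup>2 * (\<alpha> - 1) = 2 * c * \<alpha>"
      unfolding q by (simp add: algebra_simps)
    then have "(norm (v y))\<^sup>2 = 2 * c * \<alpha> / (\<alpha> - 1)"
      using \<alpha> by (simp add: eq_divide_eq)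
    then show ?thesis by (metis norm_ge_zero real_sqrt_unique)
  qed
  then show ?thesis by (auto simp: constant_on_def)
qed

text \<open>Constant length and one nonzero value leave no zeros, so the hairy ball theorem
  applies.\<close>

lemma even_dimension:
  assumes "(\<lambda>y. norm (v y)) constant_on sphere 0 1" and "\<exists>y\<in>sphere 0 1. v y \<noteq> 0"
  shows "even CARD('n)"
proof (rule hairy_ball)
  have "continuous_on (sphere 0 1) V"
    by (rule continuous_on_subset[OF continuous_on_V]) auto
  then show "continuous_on (sphere 0 1) v"
    by (rule continuous_on_eq) (simp add: V_unit)
next
  fix y :: "real^'n" assume y: "y \<in> sphere 0 1"
  then show "v y \<bullet> y = 0"
    using V_orthogonal[of y] by (simp add: V_unit)
  show "v y \<noteq> 0"
    using assms y unfolding constant_on_def by (metis norm_eq_zero)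
qed

end

text \<open>The equivalence is stated for \<open>v\<close> not identically zero on the sphere: the
  zero field with f = q = 0 is a solution for every \<alpha> and n. The profiles are determined on
  the sphere only, where they enter the ansatz.\<close>

theorem theorem1p2:
  fixes v :: "real^'n \<Rightarrow> real^'n" and \<alpha> :: real
  assumes "CARD('n) \<ge> 4"
    and "\<alpha> \<noteq> 1" and "\<alpha> \<noteq> real CARD('n) - 1"
    and "geodesible v"
  shows
    "((\<exists>y\<in>sphere 0 1. v y \<noteq> 0) \<longrightarrow>
        ((\<exists>f q. homogeneous_solution \<alpha> (homogeneous_velocity \<alpha> v f) (homogeneous_pressure \<alpha> q)) \<longleftrightarrow>
         \<alpha> \<noteq> 0 \<and> even CARD('n) \<and> (\<lambda>y. norm (v y)) constant_on sphere 0 1)) \<and>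
     (\<alpha> \<noteq> 0 \<and> even CARD('n) \<and> (\<lambda>y. norm (v y)) constant_on sphere 0 1 \<longrightarrow>
        (\<forall>f q.
          (homogeneous_solution \<alpha> (homogeneous_velocity \<alpha> v f) (homogeneous_pressure \<alpha> q) \<longleftrightarrow>
           (\<forall>y\<in>sphere 0 1. f y = 0 \<and> q y = - (1 / (2 * \<alpha>)) * (norm (v y))\<^sup>2)) \<and>
          (homogeneous_solution \<alpha> (homogeneous_velocity \<alpha> v f) (homogeneous_pressure \<alpha> q) \<longrightarrow>
           (\<forall>x. x \<noteq> 0 \<longrightarrow>
              bernoulli (homogeneous_velocity \<alpha> v f) (homogeneous_pressure \<alpha> q) x =
              1/2 * (1 - 1/\<alpha>) * (1 / norm x powr (2 * \<alpha>)) * (norm (v (x /\<^sub>R norm x)))\<^sup>2))))"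
proof -
  interpret geodesible_field v by (unfold_locales) (fact assms(4))
  let ?sol = "\<lambda>f q. homogeneous_solution \<alpha> (homogeneous_velocity \<alpha> v f) (homogeneous_pressure \<alpha> q)"
  let ?const = "(\<lambda>y. norm (v y)) constant_on sphere 0 1"
  let ?fq = "\<lambda>f q y. f y = 0 \<and> q y = - (1 / (2 * \<alpha>)) * (norm (v y))\<^sup>2"
  have sol_iff: "?sol f q \<longleftrightarrow> (\<forall>y\<in>sphere 0 1. ?fq f q y)" if "\<alpha> \<noteq> 0" "?const" for f q
  proof
    assume sol: "?sol f q"
    show "\<forall>y\<in>sphere 0 1. ?fq f q y"
    proof
      fix y :: "real^'n" assume "y \<in> sphere 0 1"
      note nec = solution_necessary[OF sol[unfolded homogeneous_solution_iff] assms(3) this]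
      have "q y = - (1 / (2 * \<alpha>)) * (norm (v y))\<^sup>2"
        using nec(2) \<open>\<alpha> \<noteq> 0\<close> by (simp add: field_simps)
      with nec(1) show "?fq f q y" by blast
    qed
  next
    assume "\<forall>y\<in>sphere 0 1. ?fq f q y"
    then show "?sol f q"
      unfolding homogeneous_solution_iff using that by (intro solution_sufficient) blast+
  qed
  have "\<alpha> \<noteq> 0 \<and> even CARD('n) \<and> ?const" if nz: "\<exists>y\<in>sphere 0 1. v y \<noteq> 0" and sol: "?sol f q" for f q
  proof -
    note sol = sol[unfolded homogeneous_solution_iff]
    \<comment> \<open>For \<alpha> = 0 the identity
      \<open>2 * \<alpha> * q y = - (norm (v y))\<^sup>2\<close> would fail at a point where v is
      nonzero.\<close>
    have "\<alpha> \<noteq> 0"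
      using nz solution_necessary(2)[OF sol assms(3)] by fastforce
    moreover from this have "?const"
      using norm_constant[OF sol assms(3,2)] assms(1) by simp
    ultimately show ?thesis using even_dimension nz by blast
  qed
  moreover have "?sol (\<lambda>_. 0) (\<lambda>y. - (1 / (2 * \<alpha>)) * (norm (v y))\<^sup>2)" if "\<alpha> \<noteq> 0" "?const"
    using sol_iff[OF that] by blast
  moreover have "bernoulli (homogeneous_velocity \<alpha> v f) (homogeneous_pressure \<alpha> q) x =
      1/2 * (1 - 1/\<alpha>) * (1 / norm x powr (2 * \<alpha>)) * (norm (v (x /\<^sub>R norm x)))\<^sup>2"
    if "\<alpha> \<noteq> 0" "?const" "?sol f q" "x \<noteq> 0" for f q x
  proof -
    let ?y = "x /\<^sub>R norm x"
    have fq: "f ?y = 0" "q ?y = - (1 / (2 * \<alpha>)) * (norm (v ?y))\<^sup>2"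
      using sol_iff[OF that(1,2)] that(3,4) by simp_all
    have r: "norm x powr (2 * \<alpha>) = (norm x powr \<alpha>)\<^sup>2"
      by (simp add: power2_eq_square flip: powr_add)
    \<comment> \<open>The coefficients -1/(2\<alpha>) of the pressure and 1/2 of the kinetic term
      add up to (1 - 1/\<alpha>)/2.\<close>
    have "bernoulli (homogeneous_velocity \<alpha> v f) (homogeneous_pressure \<alpha> q) x
        = 1 / (norm x powr \<alpha>)\<^sup>2 * q ?y + 1/2 * (norm (v ?y) / norm x powr \<alpha>)\<^sup>2"
      by (simp add: bernoulli_def homogeneous_velocity_def homogeneous_pressure_def Let_def fq(1) r)
    then show ?thesis
      unfolding fq(2) r by (simp add: power_divide diff_divide_distrib algebra_simps)
  qed
  ultimately show ?thesis using sol_iff by blast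
qed

end
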